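(* For any separable infinite-dimensional Banach space $X$, the following subsets of $L(X)$ are all Borel in $\big(L(X),\sigma(S_{op})\big)$: the set $L_{pb}(X)$ of power-bounded operators, the set $L_{cb}(X)$ of Cesaro-bounded operators, the set $\mathcal E(X)$ of ergodic operators, and the set $\mathcal{UE}(X)$ of uniformly ergodic operators.
   Context: $L(X)$ is the space of bounded operators on $X$, $S_{op}$ is the strong operator topology on $L(X)$ and $\sigma(S_{op})$ is the $\sigma$-algebra it generates. For $T\in L(X)$ and $n\ge1$, the $n$-th Cesaro-mean of $T$ is $A_n=\frac1n\sum_{k=0}^{n-1}T^k$. $T$ is power-bounded if $\sup_n\|T^n\|<\infty$; Cesaro-bounded if $\sup_n\|A_n\|<\infty$; ergodic if $(A_n)_n$ converges in $L(X)$ for the strong operator topology; uniformly ergodic if $(A_n)_n$ converges in $L(X)$ for the operator norm. *)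

theory Defs
  imports "HOL-Analysis.Analysis"
begin

(* The class banach provides a complete norm and real scalars only. The locale below equips such a
   space with compatible scalars from a field 'k. Taking 'k = real (sc = scaleR) and
   'k = complex covers real and complex Banach spaces alike; by Mazur's theorem these are, up to
   isomorphism, the only fields of class real_normed_field. *)

locale banach_space_over = vector_space sc
  for sc :: "'k::real_normed_field \<Rightarrow> 'a::banach \<Rightarrow> 'a" +
  assumes norm_scale: "norm (sc c x) = norm c * norm x"
    and scale_of_real: "sc (of_real r) x = r *\<^sub>R x"

(* L(X): the bounded 'k-linear operators, as a subset of the bounded real-linear ones.
   The norm inherited from the type blinfun is the usual operator norm. *)
definition bounded_operators ::
    "('k::real_normed_field \<Rightarrow> 'a::banach \<Rightarrow> 'a) \<Rightarrow> ('a \<Rightarrow>\<^sub>L 'a) set" where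
  "bounded_operators sc =
     {T. \<forall>c x. blinfun_apply T (sc c x) = sc c (blinfun_apply T x)}"

definition sot ::
    "('k::real_normed_field \<Rightarrow> 'a::banach \<Rightarrow> 'a) \<Rightarrow> ('a \<Rightarrow>\<^sub>L 'a) topology" where
  "sot sc = subtopology strong_operator_topology (bounded_operators sc)"

definition sot_borel ::
    "('k::real_normed_field \<Rightarrow> 'a::banach \<Rightarrow> 'a) \<Rightarrow> ('a \<Rightarrow>\<^sub>L 'a) measure" where
  "sot_borel sc = sigma (bounded_operators sc) {U. openin (sot sc) U}"

definition op_power :: "'a::banach \<Rightarrow>\<^sub>L 'a \<Rightarrow> nat \<Rightarrow> 'a \<Rightarrow>\<^sub>L 'a" where
  "op_power T n = ((\<lambda>S. T o\<^sub>L S) ^^ n) id_blinfun"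

(* Only meaningful for n \<ge> 1. *)
definition cesaro_mean :: "'a::banach \<Rightarrow>\<^sub>L 'a \<Rightarrow> nat \<Rightarrow> 'a \<Rightarrow>\<^sub>L 'a" where
  "cesaro_mean T n = (1 / real n) *\<^sub>R (\<Sum>k<n. op_power T k)"

definition power_bounded :: "'a::banach \<Rightarrow>\<^sub>L 'a \<Rightarrow> bool" where
  "power_bounded T \<longleftrightarrow> bdd_above (range (\<lambda>n. norm (op_power T n)))"

definition cesaro_bounded :: "'a::banach \<Rightarrow>\<^sub>L 'a \<Rightarrow> bool" where
  "cesaro_bounded T \<longleftrightarrow> bdd_above ((\<lambda>n. norm (cesaro_mean T n)) ` {1..})"

definition ergodic_operator ::
    "('k::real_normed_field \<Rightarrow> 'a::banach \<Rightarrow> 'a) \<Rightarrow> 'a \<Rightarrow>\<^sub>L 'a \<Rightarrow> bool" where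
  "ergodic_operator sc T \<longleftrightarrow> (\<exists>S. limitin (sot sc) (cesaro_mean T) S sequentially)"

definition uniformly_ergodic_operator ::
    "('k::real_normed_field \<Rightarrow> 'a::banach \<Rightarrow> 'a) \<Rightarrow> 'a \<Rightarrow>\<^sub>L 'a \<Rightarrow> bool" where
  "uniformly_ergodic_operator sc T \<longleftrightarrow>
     (\<exists>S\<in>bounded_operators sc. cesaro_mean T \<longlonglongrightarrow> S)"

lemma banach_space_over_real: "banach_space_over ((*\<^sub>R) :: real \<Rightarrow> 'a::banach \<Rightarrow> 'a)"
  by unfold_locales (simp_all add: algebra_simps)

lemma bounded_operators_real:
  "bounded_operators ((*\<^sub>R) :: real \<Rightarrow> 'a::banach \<Rightarrow> 'a) = UNIV"
  by (simp add: bounded_operators_def blinfun.scaleR_right)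

lemma topspace_sot: "topspace (sot sc) = bounded_operators sc"
  by (simp add: sot_def strong_operator_topology_topspace)

lemma sets_sot_borel:
  "sets (sot_borel sc) = sigma_sets (bounded_operators sc) {U. openin (sot sc) U}"
  unfolding sot_borel_def
  by (rule sets_measure_of) (use openin_subset topspace_sot in blast)

end

theory Submission
  imports Defs
begin

text \<open>
  Fix a countable dense set D. The norm of an operator is determined by its values on D, so it is
  Borel for the strong operator topology, and then so are all maps sending T to the norm of a
  polynomial in T. This settles the first two sets and, by completeness of L(X), the last one.
  By uniform boundedness, T is ergodic iff its Cesaro means are bounded in norm and are Cauchy at
  each point of D, which again involves only countably many Borel conditions.
\<close>

section \<open>Sequences of bounded operators\<close>

lemma uniform_boundedness:
  fixes F :: "'i \<Rightarrow> 'a::banach \<Rightarrow>\<^sub>L 'b::real_normed_vector"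
  assumes bdd: "\<And>x. bdd_above ((\<lambda>i. norm (F i x)) ` I)"
  shows "bdd_above ((\<lambda>i. norm (F i)) ` I)"
proof -
  define C where "C n = {x. \<forall>i\<in>I. norm (F i x) \<le> real n}" for n
  have closed: "closed (C n)" for n
  proof -
    have "C n = (\<Inter>i\<in>I. {x. norm (F i x) \<le> real n})"
      by (auto simp: C_def)
    also have "closed \<dots>"
      by (intro closed_INT ballI closed_Collect_le continuous_intros)
    finally show ?thesis .
  qed
  have "x \<in> \<Union>(range C)" for x
  proof -
    obtain B where B: "\<And>i. i \<in> I \<Longrightarrow> norm (F i x) \<le> B"
      using bdd[of x] by (auto simp: bdd_above_def)
    have "x \<in> C (nat \<lceil>B\<rceil>)"
      unfolding C_def using B by (auto intro: order_trans[OF _ real_nat_ceiling_ge])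
    then show ?thesis by blast
  qed
  then have UN: "\<Union>(range C) = UNIV" by blast
  have "\<exists>n. interior (C n) \<noteq> {}"
  proof (rule ccontr)
    assume "\<not> ?thesis"
    then have "(euclidean :: 'a topology) interior_of \<Union>(range C) = {}"
      using closed by (intro Baire_category_alt) (auto simp: completely_metrizable_space_euclidean)
    then show False using UN by simp
  qed
  then obtain n a where "a \<in> interior (C n)" by blast
  then obtain e where e: "e > 0" "cball a e \<subseteq> C n"
    by (meson mem_interior_cball)
  have "norm (F i) \<le> 2 * real n / e" if "i \<in> I" for i
  proof (rule norm_blinfun_bound)
    show "0 \<le> 2 * real n / e" using e by simp
    fix x
    show "norm (F i x) \<le> 2 * real n / e * norm x"
    proof (cases "x = 0")
      case False
      define z where "z = (e / norm x) *\<^sub>R x"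
      have "norm z = e" using False e by (simp add: z_def)
      then have "a \<in> C n" "a + z \<in> C n"
        using e by (auto simp: subset_iff dist_norm)
      then have "norm (F i a) \<le> n" "norm (F i (a + z)) \<le> n"
        using that by (auto simp: C_def)
      moreover have "F i z = F i (a + z) - F i a" by (simp add: blinfun.add_right)
      ultimately have "norm (F i z) \<le> 2 * real n"
        using norm_triangle_ineq4[of "F i (a + z)" "F i a"] by simp
      moreover have "norm (F i z) = e / norm x * norm (F i x)"
        using e by (simp add: z_def blinfun.scaleR_right)
      ultimately show ?thesis using e False by (simp add: field_simps)
    qed simp
  qed
  then show ?thesis by (rule bdd_aboveI2)
qed

lemma pointwise_convergent_imp_bdd_above_norm:
  fixes F :: "nat \<Rightarrow> 'a::banach \<Rightarrow>\<^sub>L 'b::real_normed_vector"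
  assumes "\<And>x. convergent (\<lambda>n. F n x)"
  shows "bdd_above (range (\<lambda>n. norm (F n)))"
proof (rule uniform_boundedness)
  fix x
  have "Bseq (\<lambda>n. F n x)" using assms by (rule convergent_imp_Bseq)
  then show "bdd_above (range (\<lambda>n. norm (F n x)))"
    by (auto simp: Bseq_def bdd_above_def)
qed

lemma norm_blinfun_le_iff_dense:
  fixes f :: "'a::real_normed_vector \<Rightarrow>\<^sub>L 'b::real_normed_vector"
  assumes "closure D = UNIV"
  shows "norm f \<le> b \<longleftrightarrow> 0 \<le> b \<and> (\<forall>d\<in>D. norm (f d) \<le> b * norm d)"
proof
  assume "norm f \<le> b"
  moreover have "norm (f d) \<le> norm f * norm d" for d by (rule norm_blinfun)
  ultimately show "0 \<le> b \<and> (\<forall>d\<in>D. norm (f d) \<le> b * norm d)"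
    by (meson mult_right_mono norm_ge_zero order_trans)
next
  assume b: "0 \<le> b \<and> (\<forall>d\<in>D. norm (f d) \<le> b * norm d)"
  have "closed {x. norm (f x) \<le> b * norm x}"
    by (intro closed_Collect_le continuous_intros)
  then have "closure D \<subseteq> {x. norm (f x) \<le> b * norm x}"
    using b by (intro closure_minimal) auto
  then show "norm f \<le> b"
    using assms b by (auto intro: norm_blinfun_bound)
qed

lemma pointwise_limit_blinfun:
  fixes F :: "nat \<Rightarrow> 'a::banach \<Rightarrow>\<^sub>L 'b::real_normed_vector"
  assumes "\<And>x. convergent (\<lambda>n. F n x)"
  obtains S :: "'a \<Rightarrow>\<^sub>L 'b" where "\<And>x. (\<lambda>n. F n x) \<longlonglongrightarrow> S x"
proof -
  define s where "s x = lim (\<lambda>n. F n x)" for x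
  have lim: "(\<lambda>n. F n x) \<longlonglongrightarrow> s x" for x
    using assms by (simp add: s_def convergent_LIMSEQ_iff)
  obtain K where K: "\<And>n. norm (F n) \<le> K"
    using pointwise_convergent_imp_bdd_above_norm[OF assms] by (auto simp: bdd_above_def)
  have "bounded_linear s"
  proof (rule bounded_linear_intro)
    fix x y
    have "(\<lambda>n. F n (x + y)) \<longlonglongrightarrow> s x + s y"
      using tendsto_add[OF lim lim] by (simp add: blinfun.add_right)
    then show "s (x + y) = s x + s y" by (rule LIMSEQ_unique[OF lim])
  next
    fix r x
    have "(\<lambda>n. F n (r *\<^sub>R x)) \<longlonglongrightarrow> r *\<^sub>R s x"
      using tendsto_scaleR[OF tendsto_const lim] by (simp add: blinfun.scaleR_right)
    then show "s (r *\<^sub>R x) = r *\<^sub>R s x" by (rule LIMSEQ_unique[OF lim])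
  next
    fix x
    have "norm (F n x) \<le> norm x * K" for n
      using norm_blinfun[of "F n" x] mult_right_mono[OF K norm_ge_zero, of n x]
      by (simp add: mult.commute)
    then show "norm (s x) \<le> norm x * K"
      by (intro LIMSEQ_le_const2[OF tendsto_norm[OF lim]]) auto
  qed
  then have "(\<lambda>n. F n x) \<longlonglongrightarrow> Blinfun s x" for x
    using lim by (simp add: bounded_linear_Blinfun_apply)
  then show thesis by (rule that)
qed

lemma pointwise_convergent_iff_dense:
  fixes F :: "nat \<Rightarrow> 'a::banach \<Rightarrow>\<^sub>L 'b::banach"
  assumes dense: "closure D = UNIV"
  shows "(\<forall>x. convergent (\<lambda>n. F n x)) \<longleftrightarrow>
    bdd_above (range (\<lambda>n. norm (F n))) \<and> (\<forall>d\<in>D. Cauchy (\<lambda>n. F n d))"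
proof (intro iffI conjI ballI allI)
  assume conv: "\<forall>x. convergent (\<lambda>n. F n x)"
  show "bdd_above (range (\<lambda>n. norm (F n)))"
    using conv by (intro pointwise_convergent_imp_bdd_above_norm) blast
  show "Cauchy (\<lambda>n. F n d)" for d
    using conv by (simp add: Cauchy_convergent_iff)
next
  fix x
  assume *: "bdd_above (range (\<lambda>n. norm (F n))) \<and> (\<forall>d\<in>D. Cauchy (\<lambda>n. F n d))"
  then obtain K0 where K0: "\<And>n. norm (F n) \<le> K0" by (auto simp: bdd_above_def)
  define K where "K = max K0 1"
  have K: "norm (F n) \<le> K" "K > 0" for n
    using K0[of n] by (auto simp: K_def)
  have "Cauchy (\<lambda>n. F n x)"
  proof (rule CauchyI)
    fix e :: real assume "e > 0"
    then have "e / (3 * K) > 0" using K by simp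
    then obtain d where d: "d \<in> D" "dist d x < e / (3 * K)"
      using dense by (metis UNIV_I closure_approachable)
    obtain N where N: "\<And>m n. m \<ge> N \<Longrightarrow> n \<ge> N \<Longrightarrow> norm (F m d - F n d) < e / 3"
      using * d \<open>e > 0\<close> by (metis CauchyD divide_pos_pos zero_less_numeral)
    have close: "norm (F n (x - d)) < e / 3" for n
    proof -
      have "norm (F n (x - d)) \<le> norm (F n) * norm (x - d)" by (rule norm_blinfun)
      also have "\<dots> \<le> K * norm (x - d)" using K by (intro mult_right_mono) auto
      also have "\<dots> < K * (e / (3 * K))"
        using d K by (intro mult_strict_left_mono) (auto simp: dist_norm norm_minus_commute)
      finally show ?thesis using K by simp
    qed
    have "norm (F m x - F n x) < e" if "m \<ge> N" "n \<ge> N" for m n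
    proof -
      have "F m x - F n x = (F m (x - d) - F n (x - d)) + (F m d - F n d)"
        by (simp add: blinfun.diff_right)
      also have "norm \<dots> \<le> (norm (F m (x - d)) + norm (F n (x - d))) + norm (F m d - F n d)"
        by (meson add_right_mono norm_triangle_ineq norm_triangle_ineq4 order_trans)
      also have "\<dots> < e" using close[of m] close[of n] N[OF that] by linarith
      finally show ?thesis .
    qed
    then show "\<exists>M. \<forall>m\<ge>M. \<forall>n\<ge>M. norm (F m x - F n x) < e" by blast
  qed
  then show "convergent (\<lambda>n. F n x)" by (simp add: Cauchy_convergent_iff)
qed

lemma limitin_strong_operator_topology:
  "limitin strong_operator_topology f S F \<longleftrightarrow>
    (\<forall>x. ((\<lambda>i. blinfun_apply (f i) x) \<longlongrightarrow> blinfun_apply S x) F)"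
proof (intro iffI allI)
  fix x
  assume "limitin strong_operator_topology f S F"
  then show "((\<lambda>i. blinfun_apply (f i) x) \<longlongrightarrow> blinfun_apply S x) F"
    using continuous_map_limit[OF strong_operator_topology_continuous_evaluation[of x]]
    by (fastforce simp: o_def)
next
  assume *: "\<forall>x. ((\<lambda>i. blinfun_apply (f i) x) \<longlongrightarrow> blinfun_apply S x) F"
  have "limitin (product_topology (\<lambda>_. euclidean) UNIV) (\<lambda>i. blinfun_apply (f i)) (blinfun_apply S) F"
    using * by (subst limitin_componentwise) auto
  then have lim: "((\<lambda>i. blinfun_apply (f i)) \<longlongrightarrow> blinfun_apply S) F"
    by (simp add: euclidean_product_topology)
  show "limitin strong_operator_topology f S F"
    unfolding limitin_def
  proof (intro conjI allI impI)
    show "S \<in> topspace strong_operator_topology" by (simp add: strong_operator_topology_topspace)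
    fix U assume "openin strong_operator_topology U \<and> S \<in> U"
    then obtain V where V: "open V" "U = blinfun_apply -` V" "S \<in> U"
      by (auto simp: strong_operator_topology_def openin_pullback_topology)
    then have "eventually (\<lambda>i. blinfun_apply (f i) \<in> V) F"
      using lim by (auto dest: topological_tendstoD)
    then show "\<forall>\<^sub>F i in F. f i \<in> U" by (simp add: V)
  qed
qed

section \<open>Measurability of vector-valued and operator-valued maps\<close>

text \<open>
  The sum of two Borel maps into a Banach space need not be Borel unless the space has a countable
  base, and separability is not available here as a type class. Measurability of all distances is
  equivalent to Borel measurability for separable targets and keeps every argument within the reals.
\<close>

definition dist_measurable :: "'w measure \<Rightarrow> ('w \<Rightarrow> 'a::real_normed_vector) \<Rightarrow> bool" where
  "dist_measurable M f \<longleftrightarrow> (\<forall>y. (\<lambda>w. norm (f w - y)) \<in> borel_measurable M)"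

definition strongly_measurable ::
    "'w measure \<Rightarrow> ('w \<Rightarrow> 'a::real_normed_vector \<Rightarrow>\<^sub>L 'b::real_normed_vector) \<Rightarrow> bool" where
  "strongly_measurable M P \<longleftrightarrow> (\<forall>x. dist_measurable M (\<lambda>w. P w x))"

lemma dist_measurableD: "dist_measurable M f \<Longrightarrow> (\<lambda>w. norm (f w - y)) \<in> borel_measurable M"
  by (simp add: dist_measurable_def)

lemma dist_measurable_norm: "dist_measurable M f \<Longrightarrow> (\<lambda>w. norm (f w)) \<in> borel_measurable M"
  using dist_measurableD[of M f 0] by simp

lemma dist_measurable_const: "dist_measurable M (\<lambda>_. c)"
  by (simp add: dist_measurable_def)

lemma dist_measurable_scaleR:
  assumes "dist_measurable M f"
  shows "dist_measurable M (\<lambda>w. c *\<^sub>R f w)"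
proof (cases "c = 0")
  case False
  have "norm (c *\<^sub>R f w - y) = \<bar>c\<bar> * norm (f w - y /\<^sub>R c)" for w y
  proof -
    have "c *\<^sub>R f w - y = c *\<^sub>R (f w - y /\<^sub>R c)"
      using False by (simp add: scaleR_diff_right)
    then show ?thesis by (metis norm_scaleR)
  qed
  with assms show ?thesis
    unfolding dist_measurable_def by (auto intro!: borel_measurable_times)
qed (simp add: dist_measurable_const)

context
  fixes D :: "'a::real_normed_vector set"
  assumes countable: "countable D" and dense: "closure D = UNIV"
begin

lemma continuous_less_dense:
  assumes "continuous_on UNIV g" "g p < (a :: real)"
  shows "\<exists>d\<in>D. g d < a"
proof -
  have "open {x. g x < a}" using assms(1) by (intro open_Collect_less) auto
  moreover have "{x. g x < a} \<inter> closure D \<noteq> {}"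
    using assms(2) dense by auto
  ultimately have "{x. g x < a} \<inter> D \<noteq> {}"
    by (simp add: open_Int_closure_eq_empty)
  then show ?thesis by blast
qed

lemma dist_measurable_add:
  assumes f: "dist_measurable M f" and g: "dist_measurable M g"
  shows "dist_measurable M (\<lambda>w. f w + g w :: 'a)"
  unfolding dist_measurable_def borel_measurable_iff_less
proof (intro allI)
  fix y a
  note [measurable] = dist_measurableD[OF f] dist_measurableD[OF g] countable
  have "norm (f w + g w - y) < a \<longleftrightarrow> (\<exists>d\<in>D. norm (f w - d) + norm (g w - (y - d)) < a)" for w
  proof
    assume "norm (f w + g w - y) < a"
    then show "\<exists>d\<in>D. norm (f w - d) + norm (g w - (y - d)) < a"
      by (intro continuous_less_dense[where p = "f w"] continuous_intros) (simp add: algebra_simps)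
  next
    assume "\<exists>d\<in>D. norm (f w - d) + norm (g w - (y - d)) < a"
    then obtain d where "norm (f w - d) + norm (g w - (y - d)) < a" by blast
    moreover have "f w + g w - y = (f w - d) + (g w - (y - d))" by simp
    ultimately show "norm (f w + g w - y) < a"
      by (metis norm_triangle_ineq le_less_trans)
  qed
  then show "{w \<in> space M. norm (f w + g w - y) < a} \<in> sets M" by simp
qed

lemma strongly_measurable_norm:
  fixes P :: "'w \<Rightarrow> 'a \<Rightarrow>\<^sub>L 'b::real_normed_vector"
  assumes "strongly_measurable M P"
  shows "(\<lambda>w. norm (P w)) \<in> borel_measurable M"
  unfolding borel_measurable_iff_le norm_blinfun_le_iff_dense[OF dense]
proof
  fix a
  have [measurable]: "(\<lambda>w. norm (P w d)) \<in> borel_measurable M" for d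
    using assms by (simp add: strongly_measurable_def dist_measurable_norm)
  note [measurable] = countable
  show "{w \<in> space M. 0 \<le> a \<and> (\<forall>d\<in>D. norm (P w d) \<le> a * norm d)} \<in> sets M"
    by measurable
qed

lemma dist_measurable_apply:
  fixes P :: "'w \<Rightarrow> 'a \<Rightarrow>\<^sub>L 'b::real_normed_vector"
  assumes P: "strongly_measurable M P" and f: "dist_measurable M f"
  shows "dist_measurable M (\<lambda>w. P w (f w))"
  unfolding dist_measurable_def borel_measurable_iff_less
proof (intro allI)
  fix y a
  have [measurable]: "(\<lambda>w. norm (P w d - y)) \<in> borel_measurable M" for d
    using P by (simp add: strongly_measurable_def dist_measurableD)
  note [measurable] = dist_measurableD[OF f] strongly_measurable_norm[OF P] countable
  have "norm (P w (f w) - y) < a \<longleftrightarrow> (\<exists>d\<in>D. norm (P w d - y) + norm (P w) * norm (f w - d) < a)"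
    for w
  proof
    assume "norm (P w (f w) - y) < a"
    then show "\<exists>d\<in>D. norm (P w d - y) + norm (P w) * norm (f w - d) < a"
      by (intro continuous_less_dense[where p = "f w"] continuous_intros) simp
  next
    assume "\<exists>d\<in>D. norm (P w d - y) + norm (P w) * norm (f w - d) < a"
    then obtain d where d: "norm (P w d - y) + norm (P w) * norm (f w - d) < a" by blast
    have "P w (f w) - y = (P w d - y) + P w (f w - d)" by (simp add: blinfun.diff_right)
    then have "norm (P w (f w) - y) \<le> norm (P w d - y) + norm (P w (f w - d))"
      by (metis norm_triangle_ineq)
    with norm_blinfun[of "P w" "f w - d"] d show "norm (P w (f w) - y) < a" by linarith
  qed
  then show "{w \<in> space M. norm (P w (f w) - y) < a} \<in> sets M" by simp
qed

lemma strongly_measurable_add: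
  assumes "strongly_measurable M P" "strongly_measurable M Q"
  shows "strongly_measurable M (\<lambda>w. P w + Q w :: 'b::real_normed_vector \<Rightarrow>\<^sub>L 'a)"
  using assms by (simp add: strongly_measurable_def plus_blinfun.rep_eq dist_measurable_add)

end

lemma strongly_measurable_const: "strongly_measurable M (\<lambda>_. P)"
  by (simp add: strongly_measurable_def dist_measurable_const)

lemma strongly_measurable_scaleR:
  "strongly_measurable M P \<Longrightarrow> strongly_measurable M (\<lambda>w. c *\<^sub>R P w)"
  by (simp add: strongly_measurable_def scaleR_blinfun.rep_eq dist_measurable_scaleR)

lemma sets_Collect_bdd_above:
  fixes f :: "'i \<Rightarrow> 'w \<Rightarrow> real"
  assumes "countable I" and [measurable]: "\<And>i. i \<in> I \<Longrightarrow> f i \<in> borel_measurable M"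
  shows "{w \<in> space M. bdd_above ((\<lambda>i. f i w) ` I)} \<in> sets M"
proof -
  note [measurable] = \<open>countable I\<close>
  have "bdd_above ((\<lambda>i. f i w) ` I) \<longleftrightarrow> (\<exists>N. \<forall>i\<in>I. f i w \<le> real N)" for w
    unfolding bdd_above_def ball_simps by (meson order_trans real_arch_simple)
  then show ?thesis by simp
qed

lemma sets_Collect_Cauchy_norm:
  fixes f :: "nat \<Rightarrow> 'w \<Rightarrow> 'a::real_normed_vector"
  assumes [measurable]: "\<And>m n. (\<lambda>w. norm (f m w - f n w)) \<in> borel_measurable M"
  shows "{w \<in> space M. Cauchy (\<lambda>n. f n w)} \<in> sets M"
proof -
  have "Cauchy (\<lambda>n. f n w) \<longleftrightarrow>
      (\<forall>k::nat. \<exists>N. \<forall>m\<in>{N..}. \<forall>n\<in>{N..}. norm (f m w - f n w) < 1 / real (Suc k))" for w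
  proof
    assume "Cauchy (\<lambda>n. f n w)"
    then show "\<forall>k::nat. \<exists>N. \<forall>m\<in>{N..}. \<forall>n\<in>{N..}. norm (f m w - f n w) < 1 / real (Suc k)"
      unfolding Cauchy_iff atLeast_iff Ball_def by (meson of_nat_0_less_iff zero_less_Suc zero_less_divide_1_iff)
  next
    assume *: "\<forall>k::nat. \<exists>N. \<forall>m\<in>{N..}. \<forall>n\<in>{N..}. norm (f m w - f n w) < 1 / real (Suc k)"
    show "Cauchy (\<lambda>n. f n w)"
    proof (rule CauchyI)
      fix e :: real assume "e > 0"
      then obtain k where "1 / real (Suc k) < e" using nat_approx_posE by blast
      with * show "\<exists>N. \<forall>m\<ge>N. \<forall>n\<ge>N. norm (f m w - f n w) < e"
        by (meson atLeast_iff less_trans)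
    qed
  qed
  then show ?thesis by simp
qed

section \<open>Cesaro means\<close>

lemma op_power_0: "op_power T 0 = id_blinfun"
  and op_power_Suc: "op_power T (Suc n) = T o\<^sub>L op_power T n"
  by (simp_all add: op_power_def)

context banach_space_over
begin

lemma sc_scaleR: "sc c (r *\<^sub>R x) = r *\<^sub>R sc c x"
  by (metis scale_left_commute scale_of_real)

lemma bounded_linear_sc: "bounded_linear (sc c)"
  by (rule bounded_linear_intro[where K = "norm c"])
    (simp_all add: scale_right_distrib sc_scaleR norm_scale)

lemma op_power_bounded_operators:
  "T \<in> bounded_operators sc \<Longrightarrow> op_power T n \<in> bounded_operators sc"
  by (induction n) (simp_all add: bounded_operators_def op_power_0 op_power_Suc)

lemma cesaro_mean_bounded_operators:
  assumes "T \<in> bounded_operators sc"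
  shows "cesaro_mean T n \<in> bounded_operators sc"
  using op_power_bounded_operators[OF assms]
  by (simp add: bounded_operators_def cesaro_mean_def scaleR_blinfun.rep_eq blinfun.sum_left
      sc_scaleR scale_sum_right)

lemma bounded_operators_limit:
  assumes "\<And>n. F n \<in> bounded_operators sc"
    and lim: "\<And>x. (\<lambda>n. blinfun_apply (F n) x) \<longlonglongrightarrow> blinfun_apply S x"
  shows "S \<in> bounded_operators sc"
  unfolding bounded_operators_def
proof (clarify)
  fix c x
  have "(\<lambda>n. F n (sc c x)) \<longlonglongrightarrow> sc c (S x)"
    using bounded_linear.tendsto[OF bounded_linear_sc lim] assms(1)
    by (simp add: bounded_operators_def)
  then show "S (sc c x) = sc c (S x)" by (rule LIMSEQ_unique[OF lim])
qed

lemma ergodic_operator_iff: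
  assumes T: "T \<in> bounded_operators sc"
  shows "ergodic_operator sc T \<longleftrightarrow> (\<forall>x. convergent (\<lambda>n. cesaro_mean T n x))"
proof -
  have iff: "ergodic_operator sc T \<longleftrightarrow>
      (\<exists>S\<in>bounded_operators sc. \<forall>x. (\<lambda>n. cesaro_mean T n x) \<longlonglongrightarrow> blinfun_apply S x)"
    unfolding ergodic_operator_def sot_def limitin_subtopology limitin_strong_operator_topology
    by (simp add: cesaro_mean_bounded_operators T Bex_def)
  show ?thesis
  proof
    assume "ergodic_operator sc T"
    then show "\<forall>x. convergent (\<lambda>n. cesaro_mean T n x)"
      unfolding iff convergent_def by blast
  next
    assume "\<forall>x. convergent (\<lambda>n. cesaro_mean T n x)"
    then obtain S where S: "\<And>x. (\<lambda>n. cesaro_mean T n x) \<longlonglongrightarrow> blinfun_apply S x"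
      using pointwise_limit_blinfun[of "cesaro_mean T"] by metis
    have "S \<in> bounded_operators sc"
      by (rule bounded_operators_limit[OF cesaro_mean_bounded_operators[OF T] S])
    with S show "ergodic_operator sc T" unfolding iff by blast
  qed
qed

lemma uniformly_ergodic_operator_iff:
  assumes T: "T \<in> bounded_operators sc"
  shows "uniformly_ergodic_operator sc T \<longleftrightarrow> Cauchy (cesaro_mean T)"
proof
  assume "uniformly_ergodic_operator sc T"
  then show "Cauchy (cesaro_mean T)"
    unfolding uniformly_ergodic_operator_def by (blast intro: LIMSEQ_imp_Cauchy)
next
  assume "Cauchy (cesaro_mean T)"
  then obtain S where S: "cesaro_mean T \<longlonglongrightarrow> S"
    by (auto simp: Cauchy_convergent_iff convergent_def)
  have "S \<in> bounded_operators sc"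
    by (rule bounded_operators_limit[of "cesaro_mean T"])
      (intro cesaro_mean_bounded_operators T blinfun.tendsto S tendsto_const)+
  with S show "uniformly_ergodic_operator sc T"
    by (auto simp: uniformly_ergodic_operator_def)
qed

end

lemma space_sot_borel: "space (sot_borel sc) = bounded_operators sc"
  by (simp add: sot_borel_def space_measure_of_conv)

lemma strongly_measurable_sot_borel:
  fixes sc :: "'k::real_normed_field \<Rightarrow> 'a::banach \<Rightarrow> 'a"
  shows "strongly_measurable (sot_borel sc) (\<lambda>T. T)"
  unfolding strongly_measurable_def dist_measurable_def borel_measurable_iff_less space_sot_borel
proof (intro allI)
  fix x y :: 'a and a :: real
  have "openin strong_operator_topology {T :: 'a \<Rightarrow>\<^sub>L 'a. \<forall>i\<in>{()}. blinfun_apply T x \<in> ball y a}"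
    by (rule strong_operator_topology_basis) auto
  then have "openin (sot sc) (bounded_operators sc \<inter> {T. blinfun_apply T x \<in> ball y a})"
    by (auto simp: sot_def openin_subtopology_Int2)
  moreover have "bounded_operators sc \<inter> {T. blinfun_apply T x \<in> ball y a}
      = {T \<in> bounded_operators sc. norm (blinfun_apply T x - y) < a}"
    by (auto simp: dist_norm norm_minus_commute)
  ultimately show "{T \<in> bounded_operators sc. norm (blinfun_apply T x - y) < a} \<in> sets (sot_borel sc)"
    unfolding sets_sot_borel by (auto intro: sigma_sets.Basic)
qed

lemma strongly_measurable_op_power:
  fixes sc :: "'k::real_normed_field \<Rightarrow> 'a::banach \<Rightarrow> 'a" and D :: "'a set"
  assumes D: "countable D" "closure D = UNIV"
  shows "strongly_measurable (sot_borel sc) (\<lambda>T. op_power T n)"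
proof (induction n)
  case (Suc n)
  then show ?case
    unfolding op_power_Suc strongly_measurable_def blinfun_apply_blinfun_compose
    by (intro allI dist_measurable_apply[OF D strongly_measurable_sot_borel]) blast
qed (simp add: op_power_0 strongly_measurable_const)

lemma strongly_measurable_cesaro_mean:
  fixes sc :: "'k::real_normed_field \<Rightarrow> 'a::banach \<Rightarrow> 'a" and D :: "'a set"
  assumes D: "countable D" "closure D = UNIV"
  shows "strongly_measurable (sot_borel sc) (\<lambda>T. cesaro_mean T n)"
proof -
  have "strongly_measurable (sot_borel sc) (\<lambda>T. \<Sum>k<m. op_power T k)" for m
    by (induction m)
      (simp_all add: strongly_measurable_const strongly_measurable_add[OF D]
        strongly_measurable_op_power[OF D])
  then show ?thesis unfolding cesaro_mean_def by (rule strongly_measurable_scaleR)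
qed

theorem proposition2p3:
  fixes sc :: "'k::real_normed_field \<Rightarrow> 'a::banach \<Rightarrow> 'a"
  assumes "banach_space_over sc"
    and "separable_space (euclidean :: 'a topology)"
    and "\<nexists>B. finite B \<and> module.span sc B = UNIV"
  shows "{T \<in> bounded_operators sc. power_bounded T} \<in> sets (sot_borel sc) \<and>
      {T \<in> bounded_operators sc. cesaro_bounded T} \<in> sets (sot_borel sc) \<and>
      {T \<in> bounded_operators sc. ergodic_operator sc T} \<in> sets (sot_borel sc) \<and>
      {T \<in> bounded_operators sc. uniformly_ergodic_operator sc T} \<in> sets (sot_borel sc)"
proof -
  interpret banach_space_over sc by fact
  let ?M = "sot_borel sc"
  obtain D :: "'a set" where D: "countable D" "closure D = UNIV"
    using assms(2) by (auto simp: separable_space_def)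
  have power: "(\<lambda>T. norm (op_power T n)) \<in> borel_measurable ?M" for n
    by (intro strongly_measurable_norm[OF D] strongly_measurable_op_power[OF D])
  have cesaro: "(\<lambda>T. norm (cesaro_mean T n)) \<in> borel_measurable ?M" for n
    by (intro strongly_measurable_norm[OF D] strongly_measurable_cesaro_mean[OF D])
  have diff: "strongly_measurable ?M (\<lambda>T. cesaro_mean T m - cesaro_mean T n)" for m n
    using strongly_measurable_add[OF D strongly_measurable_cesaro_mean[OF D]
        strongly_measurable_scaleR[OF strongly_measurable_cesaro_mean[OF D], where c = "-1"]]
    by simp
  have diff_apply: "(\<lambda>T. norm (cesaro_mean T m x - cesaro_mean T n x)) \<in> borel_measurable ?M" for m n x
    using diff[of m n]
    by (simp add: strongly_measurable_def dist_measurable_norm minus_blinfun.rep_eq)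
  have "{T \<in> bounded_operators sc. power_bounded T} \<in> sets ?M"
    unfolding power_bounded_def space_sot_borel[symmetric]
    by (rule sets_Collect_bdd_above[OF countableI_type power])
  moreover have "{T \<in> bounded_operators sc. cesaro_bounded T} \<in> sets ?M"
    unfolding cesaro_bounded_def space_sot_borel[symmetric]
    by (rule sets_Collect_bdd_above[OF countableI_type cesaro])
  moreover have "{T \<in> bounded_operators sc. ergodic_operator sc T} \<in> sets ?M"
  proof -
    have "{T \<in> space ?M. bdd_above (range (\<lambda>n. norm (cesaro_mean T n)))} \<in> sets ?M"
      by (rule sets_Collect_bdd_above[OF _ cesaro]) simp
    moreover have "{T \<in> space ?M. \<forall>d\<in>D. Cauchy (\<lambda>n. cesaro_mean T n d)} \<in> sets ?M"
      by (intro sets.sets_Collect_countable_All' D sets_Collect_Cauchy_norm diff_apply)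
    ultimately have "{T \<in> space ?M. bdd_above (range (\<lambda>n. norm (cesaro_mean T n))) \<and>
        (\<forall>d\<in>D. Cauchy (\<lambda>n. cesaro_mean T n d))} \<in> sets ?M"
      by (rule sets.sets_Collect_conj[rotated])
    also have "{T \<in> space ?M. bdd_above (range (\<lambda>n. norm (cesaro_mean T n))) \<and>
        (\<forall>d\<in>D. Cauchy (\<lambda>n. cesaro_mean T n d))} = {T \<in> bounded_operators sc. ergodic_operator sc T}"
      by (auto simp: space_sot_borel ergodic_operator_iff pointwise_convergent_iff_dense[OF D(2)])
    finally show ?thesis .
  qed
  moreover have "{T \<in> bounded_operators sc. uniformly_ergodic_operator sc T} \<in> sets ?M"
  proof -
    have "{T \<in> space ?M. Cauchy (cesaro_mean T)} \<in> sets ?M"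
      by (intro sets_Collect_Cauchy_norm strongly_measurable_norm[OF D] diff)
    also have "{T \<in> space ?M. Cauchy (cesaro_mean T)} =
        {T \<in> bounded_operators sc. uniformly_ergodic_operator sc T}"
      by (auto simp: space_sot_borel uniformly_ergodic_operator_iff)
    finally show ?thesis .
  qed
  ultimately show ?thesis by blast
qed

end
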